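(* Let $n\geq 2$. Then: (i) $\mathsf{L}_{1}=\{ \alpha\in \mathcal{O}_{n} : n\notin \mathrm{im}(\alpha)\}$ and $\lvert \mathsf{L}_{1} \rvert= \binom{2n-2}{n-2}$; (ii) $\mathsf{L}_{n}=\{ \alpha\in \mathcal{O}_{n} : 1\notin \mathrm{im}(\alpha)\}$ and $\lvert \mathsf{L}_{n} \rvert= \binom{2n-2}{n-2}$; and (iii) if $n\geq 3$, then for each $2\leq k\leq n-1$, $\mathsf{L}_{k} =\mathsf{L}_{1} \cup \mathsf{L}_{n} =\{ \alpha\in \mathcal{O}_{n} : 1\notin \mathrm{im}(\alpha) \text{ or } n\notin \mathrm{im}(\alpha)\}$ and $\lvert \mathsf{L}_{k} \rvert= \binom{2n-2}{n-2} +\binom{2n-3}{n-2}$.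
   Context: For a positive integer $n$, let $X_n=\{1<2<\cdots<n\}$ and let $\mathcal{O}_n$ be the semigroup of all order-preserving maps $\alpha: X_n\to X_n$ (i.e. $x<y$ implies $x\alpha\leq y\alpha$) under composition. Maps are written on the right and composed left to right: $x(\alpha\beta)=(x\alpha)\beta$. The image is $\mathrm{im}(\alpha)=\{x\alpha: x\in X_n\}$. For $1\leq k\leq n$, $\pi_k\in\mathcal{O}_n$ is the constant map $x\pi_k=k$ for all $x\in X_n$. For $1\leq k\leq n$, define $$\mathsf{L}_{k} = \{ \alpha \in \mathcal{O}_{n} : \alpha \beta= \pi_{k} \text{ for some } \beta\in \mathcal{O}_{n}\setminus\{\pi_k\} \}.$$ *)

theory Defs
  imports "HOL-Library.FuncSet"
begin

text \<open>
  Full transformations of the chain \<open>X n\<close> are represented by functions on \<^typ>\<open>nat\<close>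
  that are \<^const>\<open>undefined\<close> outside the chain, so that equality and cardinality of
  sets of transformations are the intended ones.
\<close>

definition X :: "nat \<Rightarrow> nat set" where
  "X n = {1..n}"

definition OP :: "nat \<Rightarrow> (nat \<Rightarrow> nat) set" where
  "OP n = {\<alpha> \<in> X n \<rightarrow>\<^sub>E X n. mono_on (X n) \<alpha>}"

text \<open>Maps act on the right: in \<open>omult n \<alpha> \<beta>\<close> the map \<open>\<alpha>\<close> is applied first.\<close>

definition omult :: "nat \<Rightarrow> (nat \<Rightarrow> nat) \<Rightarrow> (nat \<Rightarrow> nat) \<Rightarrow> nat \<Rightarrow> nat" where
  "omult n \<alpha> \<beta> = compose (X n) \<beta> \<alpha>"

definition const_map :: "nat \<Rightarrow> nat \<Rightarrow> nat \<Rightarrow> nat" where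
  "const_map n k = (\<lambda>x\<in>X n. k)"

definition L :: "nat \<Rightarrow> nat \<Rightarrow> (nat \<Rightarrow> nat) set" where
  "L n k = {\<alpha> \<in> OP n. \<exists>\<beta> \<in> OP n - {const_map n k}. omult n \<alpha> \<beta> = const_map n k}"

end

theory Submission
  imports Defs "HOL-Library.Multiset"
begin

text \<open>
  If \<open>\<alpha>\<beta> = \<pi>\<^sub>k\<close>, then \<open>\<beta>\<close> is \<open>k\<close> on the image of \<open>\<alpha>\<close>. Since \<open>\<beta>\<close> is monotone, it is
  squeezed between its values at \<open>1\<close> and \<open>n\<close>: it is bounded above by \<open>k\<close> as soon as
  \<open>n\<close> lies in the image of \<open>\<alpha>\<close>, or trivially if \<open>k = n\<close>; dually it is bounded below by \<open>k\<close>
  as soon as \<open>1\<close> lies in the image, or trivially if \<open>k = 1\<close>. So \<open>\<beta> \<noteq> \<pi>\<^sub>k\<close> forces one of the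
  two bounds to fail, that is, \<open>k < n\<close> and \<open>n\<close> is missed by \<open>\<alpha>\<close>, or \<open>k > 1\<close> and \<open>1\<close> is missed.
  In each of these cases a map that equals \<open>k\<close> except at the missed endpoint is a witness
  (\<open>L_iff_misses_endpoint\<close>). The three descriptions are the cases \<open>k = 1\<close>, \<open>k = n\<close> and
  \<open>1 < k < n\<close>.

  For the cardinalities, a map missing an endpoint is a monotone map from the chain into a
  chain with \<open>n - 1\<close> elements, and a map missing both endpoints is one into a chain with
  \<open>n - 2\<close> elements. Monotone maps from an \<open>m\<close>-chain are the same as multisets of size \<open>m\<close>
  (\<open>card_mono_maps\<close>), so they are counted by binomial coefficients. Inclusion-exclusion and
  Pascal's rule then give the size of the union.
\<close>

lemma eq_const_map_iff:
  "\<beta> \<in> X n \<rightarrow>\<^sub>E X n \<Longrightarrow> \<beta> = const_map n k \<longleftrightarrow> (\<forall>x\<in>X n. \<beta> x = k)"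
  unfolding const_map_def by (auto simp: fun_eq_iff PiE_def extensional_def)

lemma omult_eq_const_map_iff:
  "omult n \<alpha> \<beta> = const_map n k \<longleftrightarrow> (\<forall>x\<in>X n. \<beta> (\<alpha> x) = k)"
  unfolding omult_def const_map_def compose_def by (auto simp: fun_eq_iff)

lemma step_map_in_OP:
  assumes "a \<in> X n" "b \<in> X n" "a \<le> b"
  shows "(\<lambda>x\<in>X n. if x < t then a else b) \<in> OP n"
  using assms by (auto simp: OP_def mono_on_def)

text \<open>
  A monotone map other than \<open>\<pi>\<^sub>k\<close> has a value above \<open>k\<close>, and then also at \<open>n\<close>, or a value
  below \<open>k\<close>, and then also at \<open>1\<close>. The two disjuncts correspond to these two deviations.
\<close>

lemma L_iff_misses_endpoint:
  assumes k: "k \<in> X n"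
  shows "\<alpha> \<in> L n k \<longleftrightarrow>
    \<alpha> \<in> OP n \<and> (k < n \<and> n \<notin> \<alpha> ` X n \<or> 1 < k \<and> 1 \<notin> \<alpha> ` X n)"
proof (intro iffI; (elim conjE)?)
  assume "\<alpha> \<in> L n k"
  then obtain \<beta> where \<alpha>: "\<alpha> \<in> OP n" and \<beta>: "\<beta> \<in> OP n" "\<beta> \<noteq> const_map n k"
    and "omult n \<alpha> \<beta> = const_map n k"
    unfolding L_def by blast
  then have \<beta>_im: "\<beta> y = k" if "y \<in> \<alpha> ` X n" for y
    using that by (auto simp: omult_eq_const_map_iff)
  have ends: "1 \<in> X n" "n \<in> X n"
    using k by (auto simp: X_def)
  have \<beta>X: "\<beta> x \<in> X n" if "x \<in> X n" for x
    using \<beta> that by (auto simp: OP_def)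
  have squeeze: "\<beta> 1 \<le> \<beta> x \<and> \<beta> x \<le> \<beta> n" if "x \<in> X n" for x
    using \<beta>(1) that ends by (auto simp: OP_def mono_on_def X_def)
  obtain x where x: "x \<in> X n" "\<beta> x \<noteq> k"
    using \<beta> eq_const_map_iff by (auto simp: OP_def)
  have "k < n \<and> n \<notin> \<alpha> ` X n \<or> 1 < k \<and> 1 \<notin> \<alpha> ` X n"
  proof (cases "k < \<beta> x")
    case True
    then have "k < \<beta> n" "\<beta> n \<le> n"
      using squeeze[OF x(1)] \<beta>X[OF ends(2)] by (auto simp: X_def)
    then show ?thesis
      using \<beta>_im[of n] by auto
  next
    case False
    then have "\<beta> 1 < k" "1 \<le> \<beta> 1"
      using squeeze[OF x(1)] \<beta>X[OF ends(1)] x(2) by (auto simp: X_def)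
    then show ?thesis
      using \<beta>_im[of 1] by auto
  qed
  with \<alpha> show "\<alpha> \<in> OP n \<and> (k < n \<and> n \<notin> \<alpha> ` X n \<or> 1 < k \<and> 1 \<notin> \<alpha> ` X n)"
    by blast
next
  assume \<alpha>: "\<alpha> \<in> OP n"
    and miss: "k < n \<and> n \<notin> \<alpha> ` X n \<or> 1 < k \<and> 1 \<notin> \<alpha> ` X n"
  have \<alpha>X: "\<alpha> x \<in> X n" if "x \<in> X n" for x
    using \<alpha> that by (auto simp: OP_def)
  have witness: "\<alpha> \<in> L n k"
    if "\<beta> \<in> OP n" "z \<in> X n" "\<beta> z \<noteq> k" "\<And>y. y \<in> \<alpha> ` X n \<Longrightarrow> \<beta> y = k" for \<beta> z
  proof -
    have "omult n \<alpha> \<beta> = const_map n k"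
      using that(4) by (simp add: omult_eq_const_map_iff)
    moreover have "\<beta> \<noteq> const_map n k"
      using that(2,3) by (auto simp: const_map_def)
    ultimately show ?thesis
      using that(1) \<alpha> unfolding L_def by blast
  qed
  from miss show "\<alpha> \<in> L n k"
  proof
    assume *: "k < n \<and> n \<notin> \<alpha> ` X n"
    let ?\<beta> = "\<lambda>x\<in>X n. if x < n then k else n"
    show ?thesis
    proof (rule witness[of ?\<beta> n])
      show "?\<beta> \<in> OP n"
        using k by (intro step_map_in_OP) (auto simp: X_def)
      show "?\<beta> y = k" if "y \<in> \<alpha> ` X n" for y
      proof -
        have "y \<in> X n" "y \<noteq> n" using that * \<alpha>X by auto
        then show ?thesis by (auto simp: X_def)
      qed
    qed (use * k in \<open>auto simp: X_def\<close>)
  next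
    assume *: "1 < k \<and> 1 \<notin> \<alpha> ` X n"
    let ?\<beta> = "\<lambda>x\<in>X n. if x < 2 then 1 else k"
    show ?thesis
    proof (rule witness[of ?\<beta> 1])
      show "?\<beta> \<in> OP n"
        using k by (intro step_map_in_OP) (auto simp: X_def)
      show "?\<beta> y = k" if "y \<in> \<alpha> ` X n" for y
      proof -
        have "y \<in> X n" "y \<noteq> 1" using that * \<alpha>X by (auto simp del: One_nat_def)
        then show ?thesis by (auto simp: X_def)
      qed
    qed (use * k in \<open>auto simp: X_def\<close>)
  qed
qed

text \<open>
  A monotone map on \<open>{1..m}\<close> is determined by the multiset of its values: listing the
  multiset in increasing order recovers the map.
\<close>

lemma card_mono_maps:
  fixes B :: "'a::linorder set"
  assumes "finite B"
  shows "card {f \<in> {1..m} \<rightarrow>\<^sub>E B. mono_on {1..m} f} = (card B + m - 1) choose m"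
proof -
  let ?M = "{f \<in> {1..m} \<rightarrow>\<^sub>E B. mono_on {1..m} f}"
  let ?values = "\<lambda>f. mset (map f [1..<Suc m])"
  \<comment> \<open>the chain starts at \<open>1\<close>, list positions at \<open>0\<close>\<close>
  let ?enum = "\<lambda>A. \<lambda>i\<in>{1..m}. sorted_list_of_multiset A ! (i - 1)"
  have "bij_betw ?values ?M (multisets_of_size B m)"
  proof (rule bij_betw_byWitness[where f' = ?enum])
    show "\<forall>f\<in>?M. ?enum (?values f) = f"
    proof
      fix f assume f: "f \<in> ?M"
      then have "sorted (map f [1..<Suc m])"
        by (auto simp: sorted_iff_nth_mono mono_on_def simp del: upt_Suc)
      then have "sorted_list_of_multiset (?values f) = map f [1..<Suc m]"
        by (simp only: sorted_list_of_multiset_mset sort_key_id_if_sorted sorted_sort_id)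
      then show "?enum (?values f) = f"
        using f by (auto simp: fun_eq_iff PiE_def extensional_def simp del: upt_Suc)
    qed
  next
    show "\<forall>A\<in>multisets_of_size B m. ?values (?enum A) = A"
    proof
      fix A assume "A \<in> multisets_of_size B m"
      then have len: "length (sorted_list_of_multiset A) = m"
        by (metis (mono_tags, lifting) mem_Collect_eq mset_sorted_list_of_multiset
            multisets_of_size_def size_mset)
      have "map (?enum A) [1..<Suc m] = sorted_list_of_multiset A"
        by (rule nth_equalityI) (use len in \<open>auto simp del: upt_Suc\<close>)
      then show "?values (?enum A) = A"
        by (metis mset_sorted_list_of_multiset)
    qed
  next
    show "?values ` ?M \<subseteq> multisets_of_size B m"
      by (auto simp: multisets_of_size_def PiE_iff simp del: upt_Suc)
  next
    show "?enum ` multisets_of_size B m \<subseteq> ?M"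
    proof
      fix f assume "f \<in> ?enum ` multisets_of_size B m"
      then obtain A where A: "A \<in> multisets_of_size B m" and f: "f = ?enum A"
        by blast
      have len: "length (sorted_list_of_multiset A) = m"
        using A by (metis (mono_tags, lifting) mem_Collect_eq mset_sorted_list_of_multiset
            multisets_of_size_def size_mset)
      have "f i \<in> B" if "i \<in> {1..m}" for i
      proof -
        have "sorted_list_of_multiset A ! (i - 1) \<in> set (sorted_list_of_multiset A)"
          by (rule nth_mem) (use len that in auto)
        then show ?thesis
          using A that by (auto simp: f multisets_of_size_def)
      qed
      moreover have "mono_on {1..m} f"
        by (auto simp: f mono_on_def len intro!: sorted_nth_mono)
      ultimately show "f \<in> ?M"
        by (auto simp: f)
    qed
  qed
  then have "card ?M = card (multisets_of_size B m)"
    by (rule bij_betw_same_card)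
  then show ?thesis
    by (simp add: card_multisets_of_size assms)
qed

lemma card_OP_image_subset:
  assumes "B \<subseteq> X n"
  shows "card {\<alpha> \<in> OP n. \<alpha> ` X n \<subseteq> B} = (card B + n - 1) choose n"
proof -
  have "{\<alpha> \<in> OP n. \<alpha> ` X n \<subseteq> B} = {f \<in> {1..n} \<rightarrow>\<^sub>E B. mono_on {1..n} f}"
    using assms by (auto simp: OP_def X_def PiE_def Pi_def)
  moreover have "finite B"
    using assms finite_subset by (auto simp: X_def)
  ultimately show ?thesis
    by (simp only: card_mono_maps)
qed

lemma finite_OP: "finite (OP n)"
  by (rule finite_subset[of _ "X n \<rightarrow>\<^sub>E X n"]) (auto simp: OP_def X_def intro: finite_PiE)

lemma card_OP_misses_endpoint:
  assumes "n \<ge> 2" "e = 1 \<or> e = n"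
  shows "card {\<alpha> \<in> OP n. e \<notin> \<alpha> ` X n} = (2 * n - 2) choose (n - 2)"
proof -
  have "{\<alpha> \<in> OP n. e \<notin> \<alpha> ` X n} = {\<alpha> \<in> OP n. \<alpha> ` X n \<subseteq> X n - {e}}"
    by (auto simp: OP_def)
  moreover have "card (X n - {e}) = n - 1"
    using assms by (auto simp: X_def)
  ultimately have "card {\<alpha> \<in> OP n. e \<notin> \<alpha> ` X n} = (2 * n - 2) choose n"
    using card_OP_image_subset[of "X n - {e}" n] assms by (simp add: mult_2 numeral_2_eq_2)
  also have "\<dots> = (2 * n - 2) choose (n - 2)"
    using assms by (subst binomial_symmetric) auto
  finally show ?thesis .
qed

lemma card_OP_misses_both_endpoints:
  assumes "n \<ge> 3"
  shows "card {\<alpha> \<in> OP n. 1 \<notin> \<alpha> ` X n \<and> n \<notin> \<alpha> ` X n} = (2 * n - 3) choose (n - 3)"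
proof -
  have "{\<alpha> \<in> OP n. 1 \<notin> \<alpha> ` X n \<and> n \<notin> \<alpha> ` X n} = {\<alpha> \<in> OP n. \<alpha> ` X n \<subseteq> X n - {1, n}}"
    by (auto simp: OP_def simp del: One_nat_def)
  moreover have "card (X n - {1, n}) = n - 2"
    using assms by (auto simp: X_def card_Diff_subset)
  moreover have "n - 2 + n - 1 = 2 * n - 3"
    using assms by simp
  ultimately have "card {\<alpha> \<in> OP n. 1 \<notin> \<alpha> ` X n \<and> n \<notin> \<alpha> ` X n} = (2 * n - 3) choose n"
    using card_OP_image_subset[of "X n - {1, n}" n] by simp
  also have "\<dots> = (2 * n - 3) choose (n - 3)"
    using assms by (subst binomial_symmetric) auto
  finally show ?thesis .
qed

lemma card_OP_misses_some_endpoint: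
  assumes "n \<ge> 3"
  shows "card {\<alpha> \<in> OP n. 1 \<notin> \<alpha> ` X n \<or> n \<notin> \<alpha> ` X n} =
    ((2 * n - 2) choose (n - 2)) + ((2 * n - 3) choose (n - 2))"
proof -
  let ?A = "{\<alpha> \<in> OP n. 1 \<notin> \<alpha> ` X n}" and ?B = "{\<alpha> \<in> OP n. n \<notin> \<alpha> ` X n}"
  have union: "?A \<union> ?B = {\<alpha> \<in> OP n. 1 \<notin> \<alpha> ` X n \<or> n \<notin> \<alpha> ` X n}"
    and inter: "?A \<inter> ?B = {\<alpha> \<in> OP n. 1 \<notin> \<alpha> ` X n \<and> n \<notin> \<alpha> ` X n}"
    by auto
  have "card ?A + card ?B = card (?A \<union> ?B) + card (?A \<inter> ?B)"
    by (rule card_Un_Int) (use finite_OP in auto)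
  then have "2 * ((2 * n - 2) choose (n - 2)) =
      card (?A \<union> ?B) + ((2 * n - 3) choose (n - 3))"
    using assms card_OP_misses_endpoint[of n 1] card_OP_misses_endpoint[of n n]
      card_OP_misses_both_endpoints[of n] unfolding inter by simp
  moreover have "(2 * n - 2) choose (n - 2) =
      ((2 * n - 3) choose (n - 3)) + ((2 * n - 3) choose (n - 2))"
  proof -
    have "2 * n - 2 = Suc (2 * n - 3)" "n - 2 = Suc (n - 3)"
      using assms by auto
    then show ?thesis
      by (simp only: binomial_Suc_Suc)
  qed
  \<comment> \<open>Pascal's rule cancels the maps missing both endpoints against one of the two copies\<close>
  ultimately show ?thesis
    unfolding union by linarith
qed

theorem lemma1:
  fixes n :: nat
  assumes "n \<ge> 2"
  shows "(L n 1 = {\<alpha> \<in> OP n. n \<notin> \<alpha> ` X n} \<and>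
            card (L n 1) = (2 * n - 2) choose (n - 2)) \<and>
         (L n n = {\<alpha> \<in> OP n. 1 \<notin> \<alpha> ` X n} \<and>
            card (L n n) = (2 * n - 2) choose (n - 2)) \<and>
         (n \<ge> 3 \<longrightarrow> (\<forall>k \<in> {2..n - 1}.
            L n k = L n 1 \<union> L n n \<and>
            L n 1 \<union> L n n = {\<alpha> \<in> OP n. 1 \<notin> \<alpha> ` X n \<or> n \<notin> \<alpha> ` X n} \<and>
            card (L n k) = ((2 * n - 2) choose (n - 2)) + ((2 * n - 3) choose (n - 2))))"
proof -
  have "1 \<in> X n" "n \<in> X n"
    using assms by (auto simp: X_def)
  then have L1: "L n 1 = {\<alpha> \<in> OP n. n \<notin> \<alpha> ` X n}"
    and Ln: "L n n = {\<alpha> \<in> OP n. 1 \<notin> \<alpha> ` X n}"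
    using assms by (auto simp: L_iff_misses_endpoint)
  have Lk: "L n k = {\<alpha> \<in> OP n. 1 \<notin> \<alpha> ` X n \<or> n \<notin> \<alpha> ` X n}" if "k \<in> {2..n - 1}" for k
  proof -
    have "k \<in> X n" "1 < k" "k < n"
      using that by (auto simp: X_def)
    then show ?thesis
      by (auto simp: L_iff_misses_endpoint)
  qed
  have union: "L n 1 \<union> L n n = {\<alpha> \<in> OP n. 1 \<notin> \<alpha> ` X n \<or> n \<notin> \<alpha> ` X n}"
    unfolding L1 Ln by auto
  show ?thesis
    using L1 Ln Lk union assms card_OP_misses_endpoint[of n 1] card_OP_misses_endpoint[of n n]
      card_OP_misses_some_endpoint[of n]
    by simp
qed

end
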